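(* Let $G$ be a graph, $\theta$ a real number, and $u,v$ distinct vertices in $P_\theta(G)\cup N_\theta(G)$. Then $A_\theta(G)$ is a $\theta$-extreme set in $G\setminus\{u,v\}$, i.e. $\mathrm{mult}(\theta,G\setminus(A_\theta(G)\cup\{u,v\}))=\mathrm{mult}(\theta,G\setminus\{u,v\})+|A_\theta(G)|$.
   Context: All graphs are finite and simple. For a graph $G$ on $n$ vertices, let $p(G,r)$ be the number of $r$-matchings of $G$ ($p(G,0)=1$); the matching polynomial is $\mu(G,x)=\sum_{r=0}^{\lfloor n/2\rfloor}(-1)^r p(G,r)x^{n-2r}$. For real $\theta$, $\mathrm{mult}(\theta,G)$ is the multiplicity of $\theta$ as a root of $\mu(G,x)$ (it is $0$ if $\theta$ is not a root). $G\setminus X$ denotes deletion of the vertex set $X$; $G\setminus u=G\setminus\{u\}$. A vertex $u$ is $\theta$-essential, $\theta$-neutral, or $\theta$-positive in $G$ according as $\mathrm{mult}(\theta,G\setminus u)$ equals $\mathrm{mult}(\theta,G)-1$, $\mathrm{mult}(\theta,G)$, or $\mathrm{mult}(\theta,G)+1$. A vertex is $\theta$-special if it is not $\theta$-essential but is adjacent to a $\theta$-essential vertex. $A_\theta(G)$, $N_\theta(G)$ are the sets of $\theta$-special and $\theta$-neutral vertices, and $P_\theta(G)$ is the set of $\theta$-positive vertices that are not $\theta$-special. A set $X$ is $\theta$-extreme in a graph $F$ if $\mathrm{mult}(\theta,F\setminus X)=\mathrm{mult}(\theta,F)+|X|$. *)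

theory Defs
  imports "HOL-Computational_Algebra.Polynomial"
begin

text \<open>A finite simple graph is given by a finite vertex set V and a symmetric,
irreflexive adjacency relation E.  Only edges between vertices of V count, so
deleting a vertex set X is modelled by replacing V by V - X.\<close>

definition simple_graph :: "'a set \<Rightarrow> ('a \<Rightarrow> 'a \<Rightarrow> bool) \<Rightarrow> bool" where
  "simple_graph V E \<longleftrightarrow> finite V \<and> (\<forall>x y. E x y \<longrightarrow> E y x) \<and> (\<forall>x. \<not> E x x)"

definition graph_edges :: "'a set \<Rightarrow> ('a \<Rightarrow> 'a \<Rightarrow> bool) \<Rightarrow> 'a set set" where
  "graph_edges V E = {{x, y} | x y. x \<in> V \<and> y \<in> V \<and> E x y}"

definition matchings :: "'a set \<Rightarrow> ('a \<Rightarrow> 'a \<Rightarrow> bool) \<Rightarrow> nat \<Rightarrow> 'a set set set" where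
  "matchings V E r = {M. M \<subseteq> graph_edges V E \<and> card M = r \<and> pairwise disjnt M}"

definition num_matchings :: "'a set \<Rightarrow> ('a \<Rightarrow> 'a \<Rightarrow> bool) \<Rightarrow> nat \<Rightarrow> nat" where
  "num_matchings V E r = card (matchings V E r)"

definition match_poly :: "'a set \<Rightarrow> ('a \<Rightarrow> 'a \<Rightarrow> bool) \<Rightarrow> real poly" where
  "match_poly V E = (\<Sum>r \<le> card V div 2.
      smult ((-1) ^ r * real (num_matchings V E r)) (monom 1 (card V - 2 * r)))"

definition mmult :: "real \<Rightarrow> 'a set \<Rightarrow> ('a \<Rightarrow> 'a \<Rightarrow> bool) \<Rightarrow> nat" where
  "mmult \<theta> V E = order \<theta> (match_poly V E)"

definition essential :: "real \<Rightarrow> 'a set \<Rightarrow> ('a \<Rightarrow> 'a \<Rightarrow> bool) \<Rightarrow> 'a \<Rightarrow> bool" where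
  "essential \<theta> V E u \<longleftrightarrow> int (mmult \<theta> (V - {u}) E) = int (mmult \<theta> V E) - 1"

definition neutral :: "real \<Rightarrow> 'a set \<Rightarrow> ('a \<Rightarrow> 'a \<Rightarrow> bool) \<Rightarrow> 'a \<Rightarrow> bool" where
  "neutral \<theta> V E u \<longleftrightarrow> mmult \<theta> (V - {u}) E = mmult \<theta> V E"

definition positive :: "real \<Rightarrow> 'a set \<Rightarrow> ('a \<Rightarrow> 'a \<Rightarrow> bool) \<Rightarrow> 'a \<Rightarrow> bool" where
  "positive \<theta> V E u \<longleftrightarrow> mmult \<theta> (V - {u}) E = mmult \<theta> V E + 1"

definition special :: "real \<Rightarrow> 'a set \<Rightarrow> ('a \<Rightarrow> 'a \<Rightarrow> bool) \<Rightarrow> 'a \<Rightarrow> bool" where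
  "special \<theta> V E u \<longleftrightarrow> \<not> essential \<theta> V E u \<and> (\<exists>w \<in> V. E u w \<and> essential \<theta> V E w)"

definition A_set :: "real \<Rightarrow> 'a set \<Rightarrow> ('a \<Rightarrow> 'a \<Rightarrow> bool) \<Rightarrow> 'a set" where
  "A_set \<theta> V E = {u \<in> V. special \<theta> V E u}"

definition N_set :: "real \<Rightarrow> 'a set \<Rightarrow> ('a \<Rightarrow> 'a \<Rightarrow> bool) \<Rightarrow> 'a set" where
  "N_set \<theta> V E = {u \<in> V. neutral \<theta> V E u}"

definition P_set :: "real \<Rightarrow> 'a set \<Rightarrow> ('a \<Rightarrow> 'a \<Rightarrow> bool) \<Rightarrow> 'a set" where
  "P_set \<theta> V E = {u \<in> V. positive \<theta> V E u \<and> \<not> special \<theta> V E u}"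

definition extreme :: "real \<Rightarrow> 'a set \<Rightarrow> ('a \<Rightarrow> 'a \<Rightarrow> bool) \<Rightarrow> 'a set \<Rightarrow> bool" where
  "extreme \<theta> V E X \<longleftrightarrow> mmult \<theta> (V - X) E = mmult \<theta> V E + card X"

end

theory Submission
  imports Defs
begin

text \<open>Writing \<open>\<mu>\<^sub>S\<close> for the matching polynomial of \<open>G - S\<close>, the vertex recursion gives by induction the two
  inequalities \<open>\<mu>\<^sub>u \<mu>\<^sub>v - \<mu> \<mu>\<^sub>u\<^sub>v \<ge> 0\<close> (also with weighted vertices) and \<open>\<mu>' \<mu>\<^sub>u - \<mu> \<mu>\<^sub>u' \<ge> \<mu>\<^sub>u\<^sup>2\<close> on the real line.
  Comparing lowest-order terms at \<open>\<theta>\<close>, the second one yields interlacing of multiplicities and a sign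
  condition which makes a vertex \<open>u\<close> positive as soon as some neighbour is essential in \<open>G - u\<close>; the first
  one, whose left-hand side has even order at \<open>\<theta>\<close>, shows that essential vertices stay essential when a
  non-essential vertex is deleted. Hence a special vertex \<open>a\<close> is positive, and it is also positive in
  \<open>G - v\<close> for every other vertex \<open>v\<close>. So deleting \<open>a\<close> preserves all vertex types, and since \<open>a\<close> is still
  special in \<open>G - u\<close>, it is positive in \<open>G - {u, v}\<close>; removing the special vertices one at a time gives
  the theorem.\<close>

section \<open>Local factorisations of real polynomials\<close>

lemma order_eqI_local:
  fixes p q :: "real poly"
  assumes "p = [:-\<theta>, 1:] ^ n * q" "poly q \<theta> \<noteq> 0"
  shows "order \<theta> p = n"
proof -
  have "q \<noteq> 0" using assms(2) by auto
  then have "order \<theta> p = order \<theta> ([:-\<theta>, 1:] ^ n) + order \<theta> q"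
    unfolding assms(1) by (intro order_mult) auto
  then show ?thesis using order_0I[OF assms(2)] order_power_n_n[of \<theta> n] by simp
qed

text \<open>Puts several polynomials over one common power of \<open>x - \<theta>\<close>, while the
  value of each cofactor at \<open>\<theta>\<close> still records whether its order exceeds
  \<open>n\<close>.\<close>

lemma factor_le_order:
  fixes p :: "real poly"
  assumes "p \<noteq> 0" "n \<le> order \<theta> p"
  obtains q where "p = [:-\<theta>, 1:] ^ n * q" "poly q \<theta> = 0 \<longleftrightarrow> n < order \<theta> p"
proof -
  obtain q where q: "p = [:-\<theta>, 1:] ^ n * q"
    using order_divides[of \<theta> n p] assms by (auto elim: dvdE)
  have "q \<noteq> 0" using q assms by auto
  then have "order \<theta> p = n + order \<theta> q"
    unfolding q using order_power_n_n[of \<theta> n] by (subst order_mult) auto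
  then show ?thesis using that[OF q] order_root[of q \<theta>] \<open>q \<noteq> 0\<close> by auto
qed

text \<open>To the right of \<open>\<theta>\<close> the power is positive, so \<open>q\<close> and
  its right limit at \<open>\<theta>\<close> are nonnegative. For odd \<open>n\<close> the power is
  negative on the left, so the left limit gives the opposite sign.\<close>

lemma nonneg_local_factor:
  fixes q :: "real poly"
  assumes nonneg: "\<And>x. 0 \<le> poly ([:-\<theta>, 1:] ^ n * q) x"
  shows "0 \<le> poly q \<theta>" and "odd n \<Longrightarrow> poly q \<theta> = 0"
proof -
  have *: "0 \<le> (x - \<theta>) ^ n * poly q x" for x
    using nonneg[of x] by (simp add: algebra_simps)
  have right: "0 \<le> poly q x" if "x > \<theta>" for x
    using *[of x] that mult_pos_neg[of "(x - \<theta>) ^ n" "poly q x"] by (meson diff_gt_0_iff_gt not_less zero_less_power)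
  have lim: "(poly q \<longlongrightarrow> poly q \<theta>) (at \<theta> within S)" for S
    using tendsto_poly[OF tendsto_ident_at, of q \<theta> S] by simp
  show ge: "0 \<le> poly q \<theta>"
    by (rule tendsto_lowerbound[OF lim[of "{\<theta><..}"]])
      (auto simp: eventually_at_right_field right intro!: exI[of _ "\<theta> + 1"])
  assume "odd n"
  then have left: "poly q x \<le> 0" if "x < \<theta>" for x
    using *[of x] that zero_less_power_eq[of "x - \<theta>" n]
    by (auto simp: zero_le_mult_iff power_less_zero_eq zero_le_power_eq)
  have "poly q \<theta> \<le> 0"
    by (rule tendsto_upperbound[OF lim[of "{..<\<theta>}"]])
      (auto simp: eventually_at_left_field left intro!: exI[of _ "\<theta> - 1"])
  with ge show "poly q \<theta> = 0" by simp
qed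

section \<open>The vertex recursion\<close>

locale adjacency =
  fixes E :: "'a \<Rightarrow> 'a \<Rightarrow> bool"
  assumes sym: "E x y \<Longrightarrow> E y x"
    and irrefl: "\<not> E x x"
begin

lemma graph_edgesE:
  assumes "e \<in> graph_edges V E"
  obtains x y where "e = {x, y}" "x \<in> V" "y \<in> V" "E x y" "x \<noteq> y"
  using assms irrefl unfolding graph_edges_def by blast

lemma finite_graph_edges:
  assumes "finite V"
  shows "finite (graph_edges V E)"
  by (rule finite_subset[of _ "Pow V"]) (auto simp: graph_edges_def assms)

lemma graph_edges_Diff: "e \<in> graph_edges (V - S) E \<longleftrightarrow> e \<in> graph_edges V E \<and> e \<inter> S = {}"
  unfolding graph_edges_def by blast

lemma finite_matching:
  assumes "M \<in> matchings V E r" "finite V"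
  shows "finite M"
  using assms finite_graph_edges[of V] finite_subset unfolding matchings_def by blast

lemma finite_matchings:
  assumes "finite V"
  shows "finite (matchings V E r)"
  by (rule finite_subset[of _ "Pow (graph_edges V E)"])
    (auto simp: matchings_def finite_graph_edges assms)

lemma num_matchings_0:
  assumes "finite V"
  shows "num_matchings V E 0 = 1"
proof -
  have "M = {}" if "M \<in> matchings V E 0" for M
    using finite_matching[OF that assms] that by (simp add: matchings_def)
  moreover have "{} \<in> matchings V E 0" by (simp add: matchings_def)
  ultimately have "matchings V E 0 = {{}}" by blast
  then show ?thesis by (simp add: num_matchings_def)
qed

lemma num_matchings_eq_0:
  assumes "finite V" "card V < 2 * r"
  shows "num_matchings V E r = 0"
proof -
  have False if "M \<in> matchings V E r" for M
  proof -
    have M: "M \<subseteq> graph_edges V E" "card M = r" "pairwise disjnt M"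
      using that by (auto simp: matchings_def)
    have two: "card e = 2" "e \<subseteq> V" if "e \<in> M" for e
    proof -
      have "e \<in> graph_edges V E" using M(1) that by blast
      then show "card e = 2" "e \<subseteq> V" by (auto elim!: graph_edgesE)
    qed
    have "2 * r = (\<Sum>e\<in>M. card e)" using two(1) M(2) by simp
    also have "\<dots> = card (\<Union>M)"
      using M(3) two(2) assms(1) by (intro card_Union_disjoint[symmetric]) (auto intro: finite_subset)
    also have "\<dots> \<le> card V" using two(2) by (intro card_mono assms) blast
    finally show False using assms(2) by simp
  qed
  then have "matchings V E r = {}" by blast
  then show ?thesis by (simp add: num_matchings_def)
qed

text \<open>A matching either misses \<open>u\<close> or contains exactly one edge
  \<open>{u, b}\<close>, whose removal leaves a matching of \<open>V - {u, b}\<close>.\<close>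

lemma num_matchings_Suc:
  assumes "finite V" "u \<in> V"
  shows "num_matchings V E (Suc r) = num_matchings (V - {u}) E (Suc r)
    + (\<Sum>b\<in>{b \<in> V. E u b}. num_matchings (V - {u, b}) E r)"
proof -
  let ?B = "{b \<in> V. E u b}"
  let ?I = "\<lambda>b. insert {u, b} ` matchings (V - {u, b}) E r"
  have fresh: "{u, b} \<notin> M" if "M \<in> matchings (V - {u, b}) E r" for M b
    using that graph_edges_Diff[of "{u, b}" V "{u, b}"] unfolding matchings_def by blast
  have "matchings V E (Suc r) = matchings (V - {u}) E (Suc r) \<union> (\<Union>b\<in>?B. ?I b)" (is "?L = ?R1 \<union> ?R2")
  proof (intro equalityI subsetI)
    fix M assume M: "M \<in> ?L"
    then have M': "M \<subseteq> graph_edges V E" "card M = Suc r" "pairwise disjnt M"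
      unfolding matchings_def by blast+
    show "M \<in> ?R1 \<union> ?R2"
    proof (cases "u \<in> \<Union>M")
      case False
      then have "M \<subseteq> graph_edges (V - {u}) E" using M'(1) graph_edges_Diff[of _ V "{u}"] by auto
      then show ?thesis using M' by (auto simp: matchings_def)
    next
      case True
      then obtain e where e: "e \<in> M" "u \<in> e" by auto
      then obtain b where b: "e = {u, b}" "b \<in> V" "E u b"
      proof -
        have "e \<in> graph_edges V E" using M'(1) e(1) by blast
        then obtain x y where "e = {x, y}" "x \<in> V" "y \<in> V" "E x y"
          by (rule graph_edgesE)
        then show thesis using that[of x] that[of y] e(2) sym[of x y] by auto
      qed
      have "M - {e} \<subseteq> graph_edges (V - {u, b}) E"
      proof
        fix f assume f: "f \<in> M - {e}"
        then have "f \<inter> e = {}" using M'(3) e(1) by (auto simp: pairwise_def disjnt_def)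
        then show "f \<in> graph_edges (V - {u, b}) E"
          using f M'(1) b(1) graph_edges_Diff[of f V "{u, b}"] by blast
      qed
      moreover have "card (M - {e}) = r" using M' e by (simp add: card_Diff_singleton_if)
      moreover have "pairwise disjnt (M - {e})"
        using M'(3) by (rule pairwise_subset) auto
      ultimately have "M - {e} \<in> matchings (V - {u, b}) E r" by (simp add: matchings_def)
      moreover have "M = insert {u, b} (M - {e})" using e b by auto
      ultimately show ?thesis using b by blast
    qed
  next
    fix M assume "M \<in> ?R1 \<union> ?R2"
    then show "M \<in> ?L"
    proof
      assume "M \<in> ?R1"
      then show ?thesis unfolding matchings_def using graph_edges_Diff[of _ V "{u}"] by blast
    next
      assume "M \<in> ?R2"
      then obtain b M' where b: "b \<in> V" "E u b" "M = insert {u, b} M'"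
        "M' \<in> matchings (V - {u, b}) E r" by auto
      have "{u, b} \<in> graph_edges V E" using b assms(2) unfolding graph_edges_def by blast
      moreover have "card M = Suc r"
        using fresh[OF b(4)] finite_matching[OF b(4)] assms(1) b by (auto simp: matchings_def)
      moreover have "pairwise disjnt M"
        using b(4) graph_edges_Diff[of _ V "{u, b}"] unfolding b(3) pairwise_insert matchings_def disjnt_def
        by blast
      ultimately show ?thesis
        using b(3,4) graph_edges_Diff[of _ V "{u, b}"] unfolding matchings_def by blast
    qed
  qed
  moreover have "?R1 \<inter> ?R2 = {}"
  proof -
    have "u \<notin> \<Union>M" if "M \<in> ?R1" for M
      using that graph_edges_Diff[of _ V "{u}"] unfolding matchings_def by blast
    moreover have "u \<in> \<Union>M" if "M \<in> ?R2" for M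
      using that by auto
    ultimately show ?thesis by blast
  qed
  moreover have "finite ?R2" using assms finite_matchings by auto
  ultimately have "card ?L = card ?R1 + card ?R2"
    using finite_matchings[of "V - {u}"] assms by (simp add: card_Un_disjoint)
  also have "card ?R2 = (\<Sum>b\<in>?B. card (?I b))"
  proof (rule card_UN_disjoint)
    show "\<forall>b\<in>?B. \<forall>c\<in>?B. b \<noteq> c \<longrightarrow> ?I b \<inter> ?I c = {}"
    proof (intro ballI impI, rule ccontr)
      fix b c assume *: "b \<in> ?B" "c \<in> ?B" "b \<noteq> c" "?I b \<inter> ?I c \<noteq> {}"
      then obtain M N where M: "insert {u, b} M = insert {u, c} N" "N \<in> matchings (V - {u, c}) E r" by auto
      have "{u, b} \<noteq> {u, c}" using * by (auto simp: doubleton_eq_iff)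
      then have "{u, b} \<in> N" using M(1) by auto
      then show False using M(2) graph_edges_Diff[of "{u, b}" V "{u, c}"] unfolding matchings_def by blast
    qed
  qed (use assms finite_matchings in auto)
  also have "\<dots> = (\<Sum>b\<in>?B. num_matchings (V - {u, b}) E r)"
    unfolding num_matchings_def
  proof (intro sum.cong refl card_image inj_onI)
    fix b M N
    assume "M \<in> matchings (V - {u, b}) E r" "N \<in> matchings (V - {u, b}) E r"
      and eq: "insert {u, b} M = insert {u, b} N"
    then have "{u, b} \<notin> M" "{u, b} \<notin> N" using fresh by auto
    then show "M = N" using eq by (simp add: insert_ident)
  qed
  finally show ?thesis by (simp add: num_matchings_def)
qed

text \<open>The free upper limit \<open>N\<close> lets all polynomials in the vertex recursion share
  one summation range; the added terms have coefficient zero.\<close>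

lemma match_poly_eq:
  assumes "finite V" "card V \<le> N"
  shows "match_poly V E
    = (\<Sum>r\<le>N. monom ((-1) ^ r * real (num_matchings V E r)) (card V - 2 * r))"
  unfolding match_poly_def smult_monom mult_1_right
proof (intro sum.mono_neutral_left ballI)
  fix r assume "r \<in> {..N} - {..card V div 2}"
  then have "card V < 2 * r" by auto
  then show "monom ((-1) ^ r * real (num_matchings V E r)) (card V - 2 * r) = 0"
    using assms(1) by (simp add: num_matchings_eq_0)
qed (use assms(2) in auto)

lemma match_poly_rec:
  assumes "finite V" "u \<in> V"
  shows "match_poly V E = [:0, 1:] * match_poly (V - {u}) E
    - (\<Sum>b\<in>{b \<in> V. E u b}. match_poly (V - {u, b}) E)"
proof -
  let ?B = "{b \<in> V. E u b}"
  define n where "n = card V"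
  have n: "n > 0" using assms by (auto simp: n_def card_gt_0_iff)
  have cu: "card (V - {u}) = n - 1" using assms by (simp add: n_def)
  have cb: "card (V - {u, b}) = n - 2" if "b \<in> ?B" for b
    using that assms irrefl by (subst card_Diff_subset) (auto simp: n_def card_insert_if)
  let ?m = "\<lambda>W k r. monom ((-1) ^ r * real (num_matchings W E r)) k"
  \<comment> \<open>If \<open>2 * r > n - 1\<close>, the exponent is truncated to 0 and the shift by
    one fails, but then the coefficient is zero.\<close>
  have X: "[:0, 1:] * ?m (V - {u}) (n - 1 - 2 * r) r = ?m (V - {u}) (n - 2 * r) r" for r
  proof (cases "2 * r \<le> n - 1")
    case True
    then have "n - 2 * r = Suc (n - 1 - 2 * r)" using n by auto
    then show ?thesis by (simp add: monom_Suc)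
  next
    case False
    then show ?thesis using num_matchings_eq_0[of "V - {u}" r] assms cu by simp
  qed
  have eqV: "match_poly V E = (\<Sum>r\<le>Suc n. ?m V (n - 2 * r) r)"
    using assms by (subst match_poly_eq[of _ "Suc n"]) (auto simp: n_def)
  have equ: "[:0, 1:] * match_poly (V - {u}) E = (\<Sum>r\<le>Suc n. ?m (V - {u}) (n - 2 * r) r)"
    using assms by (subst match_poly_eq[of _ "Suc n"]) (auto simp only: cu sum_distrib_left X)
  \<comment> \<open>The exponent \<open>n - 2 - 2 * r\<close> is the one of index
    \<open>Suc r\<close> for \<open>V\<close>: restoring the edge \<open>{u, b}\<close> raises the
    size of the matching by one and flips the sign.\<close>
  have eqb: "match_poly (V - {u, b}) E = (\<Sum>r\<le>n. ?m (V - {u, b}) (n - 2 * Suc r) r)" if "b \<in> ?B" for b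
    using assms cb[OF that] by (subst match_poly_eq[of _ n]) auto
  have "match_poly V E = monom 1 n + (\<Sum>r\<le>n. ?m V (n - 2 * Suc r) (Suc r))"
    unfolding eqV by (subst sum.atMost_Suc_shift) (simp add: num_matchings_0 assms)
  also have "(\<Sum>r\<le>n. ?m V (n - 2 * Suc r) (Suc r))
      = (\<Sum>r\<le>n. ?m (V - {u}) (n - 2 * Suc r) (Suc r)) - (\<Sum>r\<le>n. \<Sum>b\<in>?B. ?m (V - {u, b}) (n - 2 * Suc r) r)"
    unfolding sum_subtractf[symmetric] monom_sum[symmetric]
    by (intro sum.cong refl)
      (simp add: num_matchings_Suc[OF assms] diff_monom[symmetric] monom_sum[symmetric] sum_distrib_left sum_negf algebra_simps del: mult_Suc_right)
  also have "(\<Sum>r\<le>n. \<Sum>b\<in>?B. ?m (V - {u, b}) (n - 2 * Suc r) r) = (\<Sum>b\<in>?B. match_poly (V - {u, b}) E)"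
    by (subst sum.swap) (simp add: eqb)
  also have "monom 1 n + ((\<Sum>r\<le>n. ?m (V - {u}) (n - 2 * Suc r) (Suc r)) - (\<Sum>b\<in>?B. match_poly (V - {u, b}) E))
      = (\<Sum>r\<le>Suc n. ?m (V - {u}) (n - 2 * r) r) - (\<Sum>b\<in>?B. match_poly (V - {u, b}) E)"
    by (subst sum.atMost_Suc_shift) (simp add: num_matchings_0 assms)
  finally show ?thesis unfolding equ .
qed

lemma match_poly_nonzero:
  assumes "finite V"
  shows "match_poly V E \<noteq> 0"
proof -
  have "coeff (match_poly V E) (card V) = (\<Sum>r\<le>card V div 2. if r = 0 then 1 else 0)"
    unfolding match_poly_def coeff_sum
    by (intro sum.cong refl) (use assms num_matchings_0 in auto)
  then show ?thesis by auto
qed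

section \<open>Rayleigh and Wronskian inequalities\<close>

text \<open>Expand \<open>F V\<close> and \<open>F (V - {v})\<close> at \<open>u\<close>: the terms
  with \<open>y u\<close> cancel, a neighbour \<open>b\<close> other than \<open>v\<close> leaves
  the same difference for \<open>b\<close>, \<open>v\<close> in \<open>V - {u}\<close>, and
  \<open>v\<close> itself, if adjacent, leaves a square. The weights \<open>y\<close> may vary with
  the vertex, as \<open>rayleigh_shifted\<close> requires.\<close>

lemma rayleigh:
  fixes F :: "'a set \<Rightarrow> real"
  assumes rec: "\<And>V u. finite V \<Longrightarrow> u \<in> V \<Longrightarrow>
      F V = y u * F (V - {u}) - (\<Sum>b\<in>{b \<in> V. E u b}. F (V - {u, b}))"
    and "finite V" "u \<in> V" "v \<in> V" "u \<noteq> v"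
  shows "0 \<le> F (V - {u}) * F (V - {v}) - F V * F (V - {u, v})"
  using assms(2-)
proof (induction V arbitrary: u rule: finite_psubset_induct)
  case (psubset V)
  let ?B = "{b \<in> V - {v}. E u b}"
  let ?c = "if E u v then F (V - {u, v}) else 0"
  have "(\<Sum>b\<in>{b \<in> V. E u b}. F (V - {u, b})) = (\<Sum>b\<in>?B. F (V - {u, b})) + ?c"
  proof (cases "E u v")
    case True
    then have "{b \<in> V. E u b} = insert v ?B" using psubset by auto
    then show ?thesis using True psubset by simp
  next
    case False
    then have "{b \<in> V. E u b} = ?B" by auto
    then show ?thesis using False by simp
  qed
  then have FV: "F V = y u * F (V - {u}) - ((\<Sum>b\<in>?B. F (V - {u, b})) + ?c)"
    using rec[of V u] psubset by simp
  have "V - {v} - {u} = V - {u, v}" "V - {v} - {u, b} = V - {u, v, b}" for b by auto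
  then have Fv: "F (V - {v}) = y u * F (V - {u, v}) - (\<Sum>b\<in>?B. F (V - {u, v, b}))"
    using rec[of "V - {v}" u] psubset by simp
  have "F (V - {u}) * F (V - {v}) - F V * F (V - {u, v})
     = (\<Sum>b\<in>?B. F (V - {u, b}) * F (V - {u, v}) - F (V - {u}) * F (V - {u, v, b})) + ?c * F (V - {u, v})"
    unfolding FV Fv
    by (simp add: algebra_simps sum_subtractf sum_distrib_left sum_distrib_right)
  moreover have "0 \<le> F (V - {u, b}) * F (V - {u, v}) - F (V - {u}) * F (V - {u, v, b})" if "b \<in> ?B" for b
  proof -
    have "V - {u} - {b} = V - {u, b}" "V - {u} - {v} = V - {u, v}" "V - {u} - {b, v} = V - {u, v, b}"
      by auto
    then show ?thesis
      using psubset.IH[of "V - {u}" b] psubset.prems that irrefl by auto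
  qed
  then have "0 \<le> (\<Sum>b\<in>?B. F (V - {u, b}) * F (V - {u, v}) - F (V - {u}) * F (V - {u, v, b}))"
    by (rule sum_nonneg)
  ultimately show ?case by auto
qed

lemma rayleigh_match_poly:
  assumes "finite V" "u \<in> V" "v \<in> V" "u \<noteq> v"
  shows "0 \<le> poly (match_poly (V - {u}) E * match_poly (V - {v}) E
    - match_poly V E * match_poly (V - {u, v}) E) x"
  using rayleigh[of "\<lambda>V. poly (match_poly V E) x" "\<lambda>_. x", OF _ assms]
  by (simp add: match_poly_rec poly_sum)

text \<open>The polynomial of \<open>V\<close> plus \<open>s\<close> times that of \<open>V - {w}\<close> is the matching polynomial in which the
  vertex \<open>w\<close> carries the weight \<open>x + s\<close> instead of \<open>x\<close>.\<close>

lemma rayleigh_shifted: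
  fixes s x :: real
  assumes "finite V" "u \<in> V" "v \<in> V" "u \<noteq> v" "w \<in> V" "w \<noteq> u" "w \<noteq> v"
  defines "\<mu> \<equiv> \<lambda>S. poly (match_poly (V - S) E) x"
  shows "0 \<le> (\<mu> {u} + s * \<mu> {u, w}) * (\<mu> {v} + s * \<mu> {v, w})
    - (\<mu> {} + s * \<mu> {w}) * (\<mu> {u, v} + s * \<mu> {u, v, w})"
proof -
  define m where "m = (\<lambda>V. poly (match_poly V E) x)"
  define F where "F = (\<lambda>V. m V + (if w \<in> V then s * m (V - {w}) else 0))"
  have mrec: "m V = x * m (V - {u}) - (\<Sum>b\<in>{b \<in> V. E u b}. m (V - {u, b}))"
    if "finite V" "u \<in> V" for V u
    using that by (simp add: m_def match_poly_rec[of V u] poly_sum)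
  have "F V = (if u = w then x + s else x) * F (V - {u}) - (\<Sum>b\<in>{b \<in> V. E u b}. F (V - {u, b}))"
    if V: "finite V" "u \<in> V" for V u
  proof (cases "w \<in> V \<and> u \<noteq> w")
    \<comment> \<open>Either \<open>w\<close> is absent and \<open>F\<close> is \<open>m\<close>, or
      \<open>u = w\<close> and the extra summand turns the weight \<open>x\<close> into
      \<open>x + s\<close>.\<close>
    case False
    then show ?thesis using mrec[OF V] V by (auto simp: F_def algebra_simps)
  next
    case True
    let ?B = "{b \<in> V. E u b}"
    \<comment> \<open>The neighbour \<open>b = w\<close> has no \<open>s\<close> part, so the
      \<open>s\<close> parts form the sum in the recursion of \<open>m (V - {w})\<close> at
      \<open>u\<close>.\<close>
    have "(\<Sum>b\<in>?B. F (V - {u, b})) = (\<Sum>b\<in>?B. m (V - {u, b})) + (\<Sum>b\<in>?B. if b = w then 0 else s * m (V - {u, b} - {w}))"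
      using True by (auto simp: F_def sum.distrib[symmetric] intro!: sum.cong)
    also have "(\<Sum>b\<in>?B. if b = w then 0 else s * m (V - {u, b} - {w}))
        = (\<Sum>b\<in>{b \<in> V - {w}. E u b}. s * m (V - {u, b} - {w}))"
      using V by (intro sum.mono_neutral_cong_right) auto
    also have "\<dots> = s * (\<Sum>b\<in>{b \<in> V - {w}. E u b}. m (V - {w} - {u, b}))"
      unfolding sum_distrib_left
      by (intro sum.cong refl arg_cong[of _ _ "\<lambda>A. s * m A"]) auto
    finally have sum: "(\<Sum>b\<in>?B. F (V - {u, b})) = (\<Sum>b\<in>?B. m (V - {u, b})) + \<dots>" .
    have "V - {u} - {w} = V - {w} - {u}" by auto
    then have "F V - x * F (V - {u}) = m V - x * m (V - {u}) + s * (m (V - {w}) - x * m (V - {w} - {u}))"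
      using True by (auto simp: F_def algebra_simps)
    then show ?thesis
      using True mrec[OF V] mrec[of "V - {w}" u] V by (simp add: sum algebra_simps)
  qed
  from rayleigh[of F "\<lambda>u. if u = w then x + s else x", OF this assms(1-4)]
  have "0 \<le> F (V - {u}) * F (V - {v}) - F V * F (V - {u, v})" by simp
  moreover have "V - {u} - {w} = V - {u, w}" "V - {v} - {w} = V - {v, w}" "V - {u, v} - {w} = V - {u, v, w}" by auto
  ultimately show ?thesis using assms(5-7) by (simp add: F_def m_def \<mu>_def)
qed

text \<open>In the recursion at \<open>u\<close>, differentiating the factor \<open>x\<close>
  produces the square, and each neighbour \<open>b\<close> contributes the Wronskian of
  \<open>V - {u}\<close> and \<open>b\<close>, nonnegative by induction.\<close>

lemma wronskian:
  assumes "finite V" "u \<in> V"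
  defines "p \<equiv> match_poly V E" and "q \<equiv> match_poly (V - {u}) E"
  shows "(poly q x)\<^sup>2 \<le> poly (pderiv p * q - p * pderiv q) x"
  using assms(1,2) unfolding p_def q_def
proof (induction V arbitrary: u rule: finite_psubset_induct)
  case (psubset V)
  let ?B = "{b \<in> V. E u b}" and ?q = "match_poly (V - {u}) E" and ?r = "\<lambda>b. match_poly (V - {u, b}) E"
  have "poly (pderiv (match_poly V E) * ?q - match_poly V E * pderiv ?q) x
    = (poly ?q x)\<^sup>2 + (\<Sum>b\<in>?B. poly (pderiv ?q * ?r b - ?q * pderiv (?r b)) x)"
    unfolding match_poly_rec[OF psubset.hyps psubset.prems]
    by (simp add: pderiv_diff higher_pderiv_sum[of 1, simplified] pderiv_pCons poly_sum sum_subtractf sum_distrib_left sum_distrib_right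
        power2_eq_square algebra_simps)
  moreover have "0 \<le> poly (pderiv ?q * ?r b - ?q * pderiv (?r b)) x" if "b \<in> ?B" for b
  proof -
    have eq: "V - {u} - {b} = V - {u, b}" by auto
    have "V - {u} \<subset> V" "b \<in> V - {u}" using that irrefl psubset.prems by auto
    from order_trans[OF zero_le_power2 psubset.IH[OF this]] show ?thesis unfolding eq .
  qed
  then have "0 \<le> (\<Sum>b\<in>?B. poly (pderiv ?q * ?r b - ?q * pderiv (?r b)) x)"
    by (rule sum_nonneg)
  ultimately show ?case by linarith
qed

text \<open>Divide the Wronskian inequality by \<open>(x - \<theta>) ^ (2 * m)\<close> and evaluate
  at \<open>\<theta>\<close>: the derivatives of the powers leave
  \<open>(m + 1) * g * h - m * g * h = g * h\<close>.\<close>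

lemma wronskian_local:
  assumes "finite V" "u \<in> V"
    and p: "match_poly V E = [:-\<theta>, 1:] ^ Suc m * g"
    and q: "match_poly (V - {u}) E = [:-\<theta>, 1:] ^ m * h"
  shows "(poly h \<theta>)\<^sup>2 \<le> poly g \<theta> * poly h \<theta>"
proof -
  define e where "e = [:-\<theta>, 1:]"
  have de: "pderiv e = 1" by (simp add: e_def pderiv_pCons)
  let ?p = "e ^ Suc m * g" and ?q = "e ^ m * h"
  let ?w = "(of_nat (Suc m) * g + e * pderiv g) * h - g * (of_nat m * h + e * pderiv h) - h\<^sup>2"
  have dp: "pderiv ?p = e ^ m * (of_nat (Suc m) * g + e * pderiv g)"
    unfolding pderiv_mult pderiv_power_Suc de
    by (simp add: algebra_simps of_nat_poly del: of_nat_Suc)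
  \<comment> \<open>The extra factor \<open>e\<close> avoids the exponent \<open>m - 1\<close>,
    which is truncated for \<open>m = 0\<close>.\<close>
  have dq: "e * pderiv ?q = e ^ m * (of_nat m * h + e * pderiv h)"
    by (cases m)
      (simp_all add: pderiv_mult pderiv_power_Suc de algebra_simps of_nat_poly del: power_Suc of_nat_Suc,
        simp_all add: algebra_simps)
  have "pderiv ?p * ?q - ?p * pderiv ?q - ?q\<^sup>2 = pderiv ?p * ?q - e ^ m * g * (e * pderiv ?q) - ?q\<^sup>2"
    by (simp add: algebra_simps)
  also have "\<dots> = e ^ (2 * m) * ?w"
    unfolding dp dq mult_2 power_add by (simp add: power2_eq_square algebra_simps)
  finally have eq: "pderiv ?p * ?q - ?p * pderiv ?q - ?q\<^sup>2 = e ^ (2 * m) * ?w" .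
  have "0 \<le> poly (pderiv ?p * ?q - ?p * pderiv ?q - ?q\<^sup>2) x" for x
    using wronskian[OF assms(1,2), of x] unfolding p q e_def[symmetric] by simp
  then have "0 \<le> poly (e ^ (2 * m) * ?w) x" for x
    unfolding eq .
  from nonneg_local_factor(1)[OF this[unfolded e_def]] show ?thesis
    by (simp add: of_nat_poly algebra_simps)
qed

section \<open>Interlacing and persistence of vertex types\<close>

context
  fixes \<theta> :: real
begin

abbreviation (input) mult :: "'a set \<Rightarrow> nat" where
  "mult V \<equiv> mmult \<theta> V E"

lemma match_poly_factor:
  assumes "finite V" "n \<le> mult V"
  obtains q where "match_poly V E = [:-\<theta>, 1:] ^ n * q" "poly q \<theta> = 0 \<longleftrightarrow> n < mult V"
  using factor_le_order[of "match_poly V E" n \<theta>] match_poly_nonzero assms by (auto simp: mmult_def)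

text \<open>A drop by two or more would make \<open>g\<close> vanish at \<open>\<theta>\<close> in
  \<open>wronskian_local\<close>, forcing \<open>h\<close> to vanish there too.\<close>

lemma mult_le_Suc_delete:
  assumes "finite V" "u \<in> V"
  shows "mult V \<le> Suc (mult (V - {u}))"
proof (rule ccontr)
  assume *: "\<not> ?thesis"
  then obtain g where g: "match_poly V E = [:-\<theta>, 1:] ^ Suc (mult (V - {u})) * g" "poly g \<theta> = 0"
    using match_poly_factor[OF assms(1), of "Suc (mult (V - {u}))"] by auto
  obtain h where h: "match_poly (V - {u}) E = [:-\<theta>, 1:] ^ mult (V - {u}) * h" "poly h \<theta> \<noteq> 0"
    using match_poly_factor[of "V - {u}" "mult (V - {u})"] assms(1) by auto
  show False using wronskian_local[OF assms g(1) h(1)] g(2) h(2) by simp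
qed

lemma mult_delete2_ge:
  assumes "finite V" "u \<in> V" "b \<in> V" "u \<noteq> b"
  shows "mult (V - {u}) \<le> Suc (mult (V - {u, b}))"
proof -
  have "V - {u} - {b} = V - {u, b}" by auto
  then show ?thesis using mult_le_Suc_delete[of "V - {u}" b] assms by auto
qed

text \<open>By the previous bound in \<open>V - {u}\<close>, every term of the recursion is
  divisible by \<open>x - \<theta>\<close> to the power \<open>mult (V - {u}) - 1\<close>.\<close>

lemma mult_delete_le_Suc:
  assumes "finite V" "u \<in> V"
  shows "mult (V - {u}) \<le> Suc (mult V)"
proof (cases "mult (V - {u})")
  case (Suc n)
  have "[:-\<theta>, 1:] ^ n dvd match_poly (V - {u, b}) E" if "b \<in> V" "E u b" for b
    using mult_delete2_ge[of V u b] that assms irrefl Suc by (auto simp: mmult_def order_divides)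
  moreover have "[:-\<theta>, 1:] ^ n dvd match_poly (V - {u}) E"
    using Suc by (simp add: mmult_def order_divides)
  ultimately have "[:-\<theta>, 1:] ^ n dvd match_poly V E"
    unfolding match_poly_rec[OF assms] by (intro dvd_diff dvd_mult dvd_sum) auto
  then show ?thesis using Suc match_poly_nonzero[OF assms(1)] by (simp add: mmult_def order_divides)
qed simp

lemma mult_delete2_le:
  assumes "finite V" "u \<in> V" "b \<in> V" "u \<noteq> b"
  shows "mult (V - {u, b}) \<le> Suc (mult (V - {u}))"
proof -
  have "V - {u} - {b} = V - {u, b}" by auto
  then show ?thesis using mult_delete_le_Suc[of "V - {u}" b] assms by auto
qed

text \<open>By the Wronskian inequality the leading terms of the neighbours' contributions to the recursion
  all have the same sign, so they cannot cancel.\<close>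

lemma positive_if_essential_neighbour:
  assumes "finite V" "u \<in> V" "b \<in> V" "E u b" and ess: "mult (V - {u}) = Suc (mult (V - {u, b}))"
  shows "mult (V - {u}) = Suc (mult V)"
proof -
  let ?B = "{c \<in> V. E u c}" and ?n = "mult (V - {u, b})"
  obtain g where g: "match_poly (V - {u}) E = [:-\<theta>, 1:] ^ Suc ?n * g"
    using match_poly_factor[of "V - {u}" "Suc ?n"] assms by auto
  have "\<forall>c\<in>?B. \<exists>h. match_poly (V - {u, c}) E = [:-\<theta>, 1:] ^ ?n * h \<and>
      (poly h \<theta> = 0 \<longleftrightarrow> ?n < mult (V - {u, c}))" (is "\<forall>c\<in>?B. \<exists>h. ?P c h")
  proof
    fix c assume "c \<in> ?B"
    then show "\<exists>h. ?P c h"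
      using match_poly_factor[of "V - {u, c}" ?n] mult_delete2_ge[of V u c] ess assms(1,2) irrefl by force
  qed
  from bchoice[OF this] obtain h where "\<forall>c\<in>?B. ?P c (h c)" ..
  then have h: "\<And>c. c \<in> ?B \<Longrightarrow> match_poly (V - {u, c}) E = [:-\<theta>, 1:] ^ ?n * h c"
      "\<And>c. c \<in> ?B \<Longrightarrow> poly (h c) \<theta> = 0 \<longleftrightarrow> ?n < mult (V - {u, c})"
    by simp_all
  have sq: "(poly (h c) \<theta>)\<^sup>2 \<le> poly g \<theta> * poly (h c) \<theta>" if c: "c \<in> ?B" for c
  proof -
    have "V - {u} - {c} = V - {u, c}" by auto
    moreover have "c \<in> V - {u}" using c irrefl by auto
    ultimately show ?thesis
      using wronskian_local[of "V - {u}" c \<theta> ?n g "h c"] g h(1)[OF c] assms(1) by simp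
  qed
  \<comment> \<open>The cofactor of the polynomial of \<open>V\<close>; at \<open>\<theta>\<close>
    only minus the sum of the \<open>h c\<close> survives.\<close>
  define r where "r = [:0, 1:] * ([:-\<theta>, 1:] * g) - (\<Sum>c\<in>?B. h c)"
  have "match_poly V E = [:-\<theta>, 1:] ^ ?n * r"
    unfolding match_poly_rec[OF assms(1,2)] g r_def
    by (simp add: h(1) sum_distrib_left[symmetric] right_diff_distrib mult.left_commute mult.assoc
        del: mult_pCons_left mult_pCons_right)
  moreover have "poly r \<theta> \<noteq> 0"
  proof -
    \<comment> \<open>The term of \<open>b\<close> is strictly positive, since \<open>?n\<close> is
      the exact order for \<open>V - {u, b}\<close>.\<close>
    have "0 < (\<Sum>c\<in>?B. (poly (h c) \<theta>)\<^sup>2)"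
      using assms h(2)[of b] by (intro sum_pos2[of _ b]) auto
    also have "\<dots> \<le> (\<Sum>c\<in>?B. poly g \<theta> * poly (h c) \<theta>)"
      by (rule sum_mono) (use sq in blast)
    also have "\<dots> = - (poly g \<theta> * poly r \<theta>)"
      by (simp add: r_def poly_sum sum_distrib_left)
    finally show ?thesis by auto
  qed
  ultimately show ?thesis using order_eqI_local[of "match_poly V E"] ess by (simp add: mmult_def)
qed

text \<open>Otherwise deleting \<open>v\<close>, or both \<open>v\<close> and \<open>w\<close>,
  leaves the multiplicity of \<open>V\<close> unchanged while deleting \<open>w\<close> lowers it.
  The Rayleigh difference then has odd order at \<open>\<theta>\<close>, which its nonnegativity
  excludes.\<close>

lemma essential_delete_nonessential:
  assumes "finite V" "v \<in> V" "w \<in> V" "v \<noteq> w"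
    and w: "mult V = Suc (mult (V - {w}))" and v: "mult V \<le> mult (V - {v})"
  shows "mult (V - {v}) = Suc (mult (V - {v, w}))"
proof (rule ccontr)
  assume contra: "\<not> ?thesis"
  define j where "j = mult (V - {w})"
  note bounds = mult_delete_le_Suc[OF assms(1,2)] mult_delete2_ge[OF assms(1-4)]
    mult_delete2_le[OF assms(1,3,2) assms(4)[symmetric]]
  have j: "mult V = Suc j" "mult (V - {v}) = Suc j" "mult (V - {v, w}) = Suc j"
    using bounds contra v w by (auto simp: j_def insert_commute)
  obtain gw where gw: "match_poly (V - {w}) E = [:-\<theta>, 1:] ^ j * gw" "poly gw \<theta> \<noteq> 0"
    using match_poly_factor[of "V - {w}" j] assms(1) by (auto simp: j_def)
  obtain gv where gv: "match_poly (V - {v}) E = [:-\<theta>, 1:] ^ Suc j * gv" "poly gv \<theta> \<noteq> 0"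
    using match_poly_factor[of "V - {v}" "Suc j"] assms(1) j by auto
  obtain g where g: "match_poly V E = [:-\<theta>, 1:] ^ Suc j * g"
    using match_poly_factor[of V "Suc j"] assms(1) j by auto
  obtain gvw where gvw: "match_poly (V - {v, w}) E = [:-\<theta>, 1:] ^ Suc j * gvw"
    using match_poly_factor[of "V - {v, w}" "Suc j"] assms(1) j by auto
  have "match_poly (V - {v}) E * match_poly (V - {w}) E - match_poly V E * match_poly (V - {v, w}) E
     = [:-\<theta>, 1:] ^ (2 * j + 1) * (gw * gv - [:-\<theta>, 1:] * (g * gvw))"
    unfolding gw gv g gvw mult_2 power_add
    by (simp add: algebra_simps del: mult_pCons_left mult_pCons_right)
  then have "0 \<le> poly ([:-\<theta>, 1:] ^ (2 * j + 1) * (gw * gv - [:-\<theta>, 1:] * (g * gvw))) x" for x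
    using rayleigh_match_poly[OF assms(1-4), of x] by simp
  from nonneg_local_factor(2)[OF this] show False using gw gv by simp
qed

text \<open>The neighbour \<open>w\<close> stays essential after deletion of the non-essential
  \<open>a\<close>, so the neighbour criterion applies.\<close>

lemma special_positive:
  assumes "finite V" "a \<in> V" "w \<in> V" "E a w"
    and "mult V = Suc (mult (V - {w}))" "mult V \<le> mult (V - {a})"
  shows "mult (V - {a}) = Suc (mult V)"
proof -
  have "a \<noteq> w" using assms irrefl by auto
  then show ?thesis
    using essential_delete_nonessential[of V a w] positive_if_essential_neighbour[of V a w] assms by simp
qed

lemma special_positive_delete:
  assumes "finite V" "a \<in> V" "w \<in> V" "v \<in> V" "E a w" "v \<noteq> a"
    and w: "mult V = Suc (mult (V - {w}))" and a: "mult V \<le> mult (V - {a})"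
  shows "mult (V - {a, v}) = Suc (mult (V - {v}))"
proof (cases "mult V \<le> mult (V - {v})")
  \<comment> \<open>Here \<open>v\<close> is essential, and interlacing along both orders of
    deletion pins down the multiplicity.\<close>
  case False
  then show ?thesis
    using special_positive[OF assms(1-3,5) w a] mult_delete2_ge[of V a v] mult_delete2_le[of V v a] assms
    by (auto simp: insert_commute)
next
  case True
  define k where "k = mult V"
  have neq: "a \<noteq> w" "v \<noteq> w" using assms irrefl True by auto
  have sets: "V - {v} - {a} = V - {a, v}" "V - {v} - {w} = V - {v, w}"
    "V - {v} - {a, w} = V - {a, v, w}" "V - {a, v} - {w} = V - {a, v, w}" by auto
  have ka: "mult (V - {a}) = Suc k"
    using special_positive[OF assms(1-3,5) w a] by (simp add: k_def)
  have wv: "mult (V - {v}) = Suc (mult (V - {v, w}))"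
    using essential_delete_nonessential[of V v w] assms neq True by auto
  show ?thesis
  proof (cases "mult (V - {v}) \<le> mult (V - {a, v})")
    case True
    then show ?thesis
      using special_positive[of "V - {v}" a w] assms neq wv by (auto simp: sets)
  next
    case False
    txt \<open>The remaining configuration is refuted by giving \<open>w\<close> the weight \<open>x + t * (x - \<theta>)\<close>:
      the lowest-order term of the Rayleigh difference then has a sign that depends on \<open>t\<close>.\<close>
    have kv: "mult (V - {v}) = Suc k" "mult (V - {a, v}) = k"
      using False ka mult_delete2_ge[of V a v] mult_delete_le_Suc[of V v] assms by (auto simp: k_def)
    \<comment> \<open>If \<open>w\<close> were essential in \<open>V - {a, v}\<close>, the neighbour
      criterion would make \<open>a\<close> positive in \<open>V - {v}\<close>.\<close>
    have "mult (V - {a, v}) \<noteq> Suc (mult (V - {a, v, w}))"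
    proof
      assume ess: "mult (V - {a, v}) = Suc (mult (V - {a, v, w}))"
      have "mult (V - {v} - {a}) = Suc (mult (V - {v}))"
        by (rule positive_if_essential_neighbour[of _ _ w]) (use assms neq ess in \<open>auto simp: sets\<close>)
      then show False using kv by (simp add: sets)
    qed
    then have kavw: "k \<le> mult (V - {a, v, w})"
      using kv mult_le_Suc_delete[of "V - {a, v}" w] assms neq by (auto simp: sets)
    have kaw: "k \<le> mult (V - {a, w})" "k \<le> mult (V - {v, w})"
      using ka kv wv mult_delete2_ge[of V a w] assms neq by auto
    obtain j where j: "k = Suc j" "mult (V - {w}) = j" using w k_def by auto
    let ?e = "[:-\<theta>, 1:]"
    obtain g where g: "match_poly V E = ?e ^ k * g"
      using match_poly_factor[of V k] assms(1) k_def by auto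
    obtain ga where ga: "match_poly (V - {a}) E = ?e ^ Suc k * ga"
      using match_poly_factor[of "V - {a}" "Suc k"] assms(1) ka by auto
    obtain gv where gv: "match_poly (V - {v}) E = ?e ^ Suc k * gv"
      using match_poly_factor[of "V - {v}" "Suc k"] assms(1) kv by auto
    obtain gw where gw: "match_poly (V - {w}) E = ?e ^ j * gw" "poly gw \<theta> \<noteq> 0"
      using match_poly_factor[of "V - {w}" j] assms(1) j by auto
    obtain gav where gav: "match_poly (V - {a, v}) E = ?e ^ k * gav" "poly gav \<theta> \<noteq> 0"
      using match_poly_factor[of "V - {a, v}" k] assms(1) kv by auto
    obtain gaw where gaw: "match_poly (V - {a, w}) E = ?e ^ k * gaw"
      using match_poly_factor[of "V - {a, w}" k] assms(1) kaw by auto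
    obtain gvw where gvw: "match_poly (V - {v, w}) E = ?e ^ k * gvw"
      using match_poly_factor[of "V - {v, w}" k] assms(1) kaw by auto
    obtain gavw where gavw: "match_poly (V - {a, v, w}) E = ?e ^ k * gavw"
      using match_poly_factor[of "V - {a, v, w}" k] assms(1) kavw by auto
    \<comment> \<open>With this \<open>t\<close>, \<open>g + t * gw\<close> and \<open>gav\<close>
      agree at \<open>\<theta>\<close>. All other terms of \<open>?Q\<close> carry a factor
      \<open>?e\<close>, so \<open>?Q\<close> takes the value \<open>- gav\<^sup>2 < 0\<close>
      there.\<close>
    define t where "t = (poly gav \<theta> - poly g \<theta>) / poly gw \<theta>"
    let ?Q = "(?e * ga + smult t (?e * gaw)) * (?e * gv + smult t (?e * gvw))
      - (g + smult t gw) * (gav + smult t (?e * gavw))"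
    have "0 \<le> poly (?e ^ (2 * k) * ?Q) x" for x
    proof -
      let ?y = "x - \<theta>"
      have "0 \<le> (?y ^ Suc k * poly ga x + (t * ?y) * (?y ^ k * poly gaw x)) * (?y ^ Suc k * poly gv x + (t * ?y) * (?y ^ k * poly gvw x))
        - (?y ^ k * poly g x + (t * ?y) * (?y ^ j * poly gw x)) * (?y ^ k * poly gav x + (t * ?y) * (?y ^ k * poly gavw x))"
        using rayleigh_shifted[of V a v w x "t * ?y"] assms neq
        by (simp add: g ga gv gw gav gaw gvw gavw poly_mult poly_power del: mult_pCons_left power_Suc)
      also have "\<dots> = ?y ^ (2 * k) * poly ?Q x"
        unfolding mult_2 power_add by (simp add: j algebra_simps)
      finally show ?thesis by simp
    qed
    from nonneg_local_factor(1)[OF this]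
    have "(poly g \<theta> + t * poly gw \<theta>) * poly gav \<theta> \<le> 0" by simp
    moreover have "poly g \<theta> + t * poly gw \<theta> = poly gav \<theta>" using gw(2) by (simp add: t_def)
    ultimately show ?thesis using gav(2) by (auto simp: mult_le_0_iff)
  qed
qed

section \<open>Stability under deletion of special vertices\<close>

lemma essential_iff:
  assumes "finite V" "u \<in> V"
  shows "essential \<theta> V E u \<longleftrightarrow> mult V = Suc (mult (V - {u}))"
    and "\<not> essential \<theta> V E u \<longleftrightarrow> mult V \<le> mult (V - {u})"
  using mult_le_Suc_delete[OF assms] by (auto simp: essential_def)

text \<open>Deleting \<open>a\<close> raises the multiplicities of \<open>V\<close> and of every
  \<open>V - {v}\<close> by one, so the other vertices keep their types; being non-essential,
  \<open>a\<close> makes no neighbour special.\<close>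

lemma A_set_delete_special:
  assumes "finite V" "a \<in> A_set \<theta> V E"
  shows "A_set \<theta> (V - {a}) E = A_set \<theta> V E - {a}"
    and "mult (V - {a}) = Suc (mult V)"
    and "v \<in> V \<Longrightarrow> v \<noteq> a \<Longrightarrow> mult (V - {a, v}) = Suc (mult (V - {v}))"
proof -
  obtain w where aw: "a \<in> V" "w \<in> V" "E a w" "essential \<theta> V E w" "\<not> essential \<theta> V E a"
    using assms by (auto simp: A_set_def special_def)
  then have m: "mult V = Suc (mult (V - {w}))" "mult V \<le> mult (V - {a})"
    using essential_iff(1)[of V w] essential_iff(2)[of V a] assms(1) by auto
  show ma: "mult (V - {a}) = Suc (mult V)"
    using special_positive[OF assms(1) aw(1-3) m] .
  show mv: "mult (V - {a, v}) = Suc (mult (V - {v}))" if "v \<in> V" "v \<noteq> a" for v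
    using special_positive_delete[OF assms(1) aw(1,2) _ aw(3) _ m] that by auto
  have "essential \<theta> (V - {a}) E v \<longleftrightarrow> essential \<theta> V E v" if "v \<in> V" "v \<noteq> a" for v
  proof -
    have "V - {a} - {v} = V - {a, v}" by auto
    then show ?thesis using ma mv[OF that] unfolding essential_def by simp linarith
  qed
  then show "A_set \<theta> (V - {a}) E = A_set \<theta> V E - {a}"
    using aw(5) unfolding A_set_def special_def by blast
qed

text \<open>Since \<open>u\<close> is non-essential, \<open>w\<close> stays essential and
  \<open>a\<close> non-essential in \<open>V - {u}\<close>, so the single-deletion result applies
  there.\<close>

lemma special_positive_delete2:
  assumes "finite V" "a \<in> A_set \<theta> V E" "u \<in> V" "v \<in> V" "u \<noteq> v" "u \<noteq> a" "v \<noteq> a"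
    and u: "mult V \<le> mult (V - {u})"
  shows "mult (V - {a, u, v}) = Suc (mult (V - {u, v}))"
proof -
  obtain w where aw: "a \<in> V" "w \<in> V" "E a w" "essential \<theta> V E w" "\<not> essential \<theta> V E a"
    using assms by (auto simp: A_set_def special_def)
  have w: "mult V = Suc (mult (V - {w}))" using aw essential_iff assms(1) by auto
  have "u \<noteq> w" using u w by auto
  then have "mult (V - {u}) = Suc (mult (V - {u, w}))"
    using essential_delete_nonessential[of V u w] assms aw w by auto
  moreover have "mult (V - {u, a}) = Suc (mult (V - {u}))"
    using A_set_delete_special(3)[OF assms(1,2), of u] assms by (simp add: insert_commute)
  moreover have "V - {u} - {w} = V - {u, w}" "V - {u} - {a} = V - {u, a}"
    "V - {u} - {a, v} = V - {a, u, v}" "V - {u} - {v} = V - {u, v}" by auto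
  ultimately show ?thesis
    using special_positive_delete[of "V - {u}" a w v] assms aw \<open>u \<noteq> w\<close> by auto
qed

text \<open>Induction deleting one special vertex \<open>a\<close>: the conditions on
  \<open>u\<close> and \<open>v\<close> persist because both sides of each inequality grow by one,
  and the special set loses only \<open>a\<close>.\<close>

lemma mult_delete_A_set:
  assumes "finite V" "u \<in> V" "v \<in> V" "u \<noteq> v" "u \<notin> A_set \<theta> V E" "v \<notin> A_set \<theta> V E"
    and "mult V \<le> mult (V - {u})" "mult V \<le> mult (V - {v})"
  shows "mult (V - {u, v} - A_set \<theta> V E) = mult (V - {u, v}) + card (A_set \<theta> V E)"
  using assms
proof (induction V rule: finite_psubset_induct)
  case (psubset V)
  show ?case
  proof (cases "A_set \<theta> V E = {}")
    case False
    then obtain a where a: "a \<in> A_set \<theta> V E" by auto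
    then have aV: "a \<in> V" "a \<noteq> u" "a \<noteq> v" using psubset by (auto simp: A_set_def)
    note del = A_set_delete_special[OF psubset.hyps a]
    have sets: "V - {a} - {u} = V - {a, u}" "V - {a} - {v} = V - {a, v}"
      "V - {a, u, v} - (A_set \<theta> V E - {a}) = V - {u, v} - A_set \<theta> V E"
      "V - {a} - {u, v} = V - {a, u, v}" using a by auto
    have "V - {a} \<subset> V" using aV by auto
    note IH = psubset.IH[OF this, unfolded del(1) sets]
    have "mult (V - {u, v} - A_set \<theta> V E) = mult (V - {a, u, v}) + card (A_set \<theta> V E - {a})"
      by (rule IH) (use psubset.prems aV del(2) del(3)[of u] del(3)[of v] in auto)
    moreover have "mult (V - {a, u, v}) = Suc (mult (V - {u, v}))"
      using special_positive_delete2[OF psubset.hyps a] psubset.prems aV by auto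
    moreover have "card (A_set \<theta> V E) = Suc (card (A_set \<theta> V E - {a}))"
      using a psubset.hyps by (intro card.remove) (auto simp: A_set_def)
    ultimately show ?thesis by simp
  qed simp
qed

end

end

theorem theorem5p16:
  fixes V :: "'a set" and E :: "'a \<Rightarrow> 'a \<Rightarrow> bool" and \<theta> :: real and u v :: 'a
  assumes "simple_graph V E"
    and "u \<in> P_set \<theta> V E \<union> N_set \<theta> V E"
    and "v \<in> P_set \<theta> V E \<union> N_set \<theta> V E"
    and "u \<noteq> v"
  shows "extreme \<theta> (V - {u, v}) E (A_set \<theta> V E)"
proof -
  interpret adjacency E
    using assms(1) by unfold_locales (auto simp: simple_graph_def)
  have V: "finite V" using assms(1) by (simp add: simple_graph_def)
  have "x \<in> V \<and> x \<notin> A_set \<theta> V E \<and> mmult \<theta> V E \<le> mmult \<theta> (V - {x}) E"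
    if x: "x \<in> P_set \<theta> V E \<union> N_set \<theta> V E" for x
  proof -
    show ?thesis
    proof (cases "x \<in> P_set \<theta> V E")
      case True
      then show ?thesis by (simp add: P_set_def A_set_def positive_def)
    next
      case False
      then have N: "x \<in> V" "mmult \<theta> (V - {x}) E = mmult \<theta> V E"
        using x by (simp_all add: N_set_def neutral_def)
      \<comment> \<open>Unlike \<open>P_set\<close>, \<open>N_set\<close> does not exclude special
        vertices by definition; a neutral vertex is not special because special vertices are
        positive.\<close>
      then show ?thesis using A_set_delete_special(2)[OF V, of x] by auto
    qed
  qed
  then show ?thesis
    using mult_delete_A_set[OF V] assms(2-4) unfolding extreme_def by blast
qed

end
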